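(* Let $\le_t$ be the relation defined by the subtyping rules (refl), (size), (prod), (conv) only (i.e. without the rule (trans)). Then $\le_t$ equals the subtyping relation $\le$.
   Context: Sorts: $\mathcal S=\{\star,\Box\}$. Let $\mathcal X$ be a set of variables and $\mathcal F$ a set of symbols; a set $\mathcal R$ of rewrite rules is given, a symbol is defined if it heads the left-hand side of some rule and constant otherwise; $\mathcal{CF}^\Box$ denotes the constant symbols of sort $\Box$. Size expressions form a first-order term algebra $\mathcal A$ over size symbols and size variables, equipped with a quasi-ordering $\le_{\mathcal A}$. Terms: $t::= s\mid x\mid C^a\mid f\mid [x:t]t\mid (x:t)t\mid tt$ with $s\in\mathcal S$, $C\in\mathcal{CF}^\Box$, $a\in\mathcal A$, $f\in\mathcal F\setminus\mathcal{CF}^\Box$. The reduction $\to$ is $\beta\cup\mathcal R$ closed under contexts and is assumed confluent; $T\downarrow U$ means $T$ and $U$ have a common reduct. Subtyping $\le$ is the smallest relation closed under: (refl) $T\le T$; (size) $C^a\vec t\le C^b\vec t$ when $C\in\mathcal{CF}^\Box$ and $a\le_{\mathcal A}b$; (prod) from $U'\le U$ and $V\le V'$ infer $(x:U)V\le(x:U')V'$; (conv) from $T'\le U'$, $T\downarrow T'$, $U'\downarrow U$ infer $T\le U$; (trans) from $T\le U$ and $U\le V$ infer $T\le V$. *)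

theory Defs
  imports Main "HOL-Library.Confluence"
begin

text \<open>Size expressions: first-order terms over size symbols \<open>'h\<close>, with arities
  given by \<open>ar\<close>, and size variables \<open>'v\<close>.\<close>

datatype ('h, 'v) sexp = SVar 'v | SFun 'h "('h, 'v) sexp list"

inductive_set sexps :: "('h \<Rightarrow> nat) \<Rightarrow> ('h, 'v) sexp set" for ar :: "'h \<Rightarrow> nat" where
  SVar: "SVar \<alpha> \<in> sexps ar"
| SFun: "length es = ar h \<Longrightarrow> \<forall>e\<in>set es. e \<in> sexps ar \<Longrightarrow> SFun h es \<in> sexps ar"

datatype srt = Star | Box

text \<open>Raw terms modulo \<open>\<alpha>\<close>-equivalence, with de Bruijn indices for the variables:
  \<open>Lam U t\<close> is \<open>[x:U]t\<close> and \<open>Prod U V\<close> is \<open>(x:U)V\<close>, where index 0 of \<open>t\<close>, resp. \<open>V\<close>,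
  stands for \<open>x\<close>. A symbol may occur with (\<open>ACst\<close>) or without (\<open>Sym\<close>) a size annotation;
  the set \<open>terms\<close> below imposes annotations on exactly the constant symbols of sort \<open>Box\<close>.
  That set depends on the rules, which are themselves pairs of terms, so the rules are
  first given as pairs of raw terms.\<close>

datatype ('f, 'h, 'v) trm =
    Sort srt
  | Var nat
  | ACst 'f "('h, 'v) sexp"
  | Sym 'f
  | Lam "('f, 'h, 'v) trm" "('f, 'h, 'v) trm"
  | Prod "('f, 'h, 'v) trm" "('f, 'h, 'v) trm"
  | App "('f, 'h, 'v) trm" "('f, 'h, 'v) trm"

type_synonym ('f, 'h, 'v) rules = "(('f, 'h, 'v) trm \<times> ('f, 'h, 'v) trm) set"

definition apps :: "('f, 'h, 'v) trm \<Rightarrow> ('f, 'h, 'v) trm list \<Rightarrow> ('f, 'h, 'v) trm" where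
  "apps t ts = foldl App t ts"

definition heads :: "'f \<Rightarrow> ('f, 'h, 'v) trm \<Rightarrow> bool" where
  "heads f t \<longleftrightarrow> (\<exists>ts. t = apps (Sym f) ts \<or> (\<exists>a. t = apps (ACst f a) ts))"

definition defined_sym :: "('f, 'h, 'v) rules \<Rightarrow> 'f \<Rightarrow> bool" where
  "defined_sym R f \<longleftrightarrow> (\<exists>(l, r)\<in>R. heads f l)"

definition CFBox :: "('f \<Rightarrow> srt) \<Rightarrow> ('f, 'h, 'v) rules \<Rightarrow> 'f set" where
  "CFBox sr R = {f. sr f = Box \<and> \<not> defined_sym R f}"

inductive_set terms ::
    "('h \<Rightarrow> nat) \<Rightarrow> ('f \<Rightarrow> srt) \<Rightarrow> ('f, 'h, 'v) rules \<Rightarrow> ('f, 'h, 'v) trm set"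
  for ar :: "'h \<Rightarrow> nat" and sr :: "'f \<Rightarrow> srt" and R :: "('f, 'h, 'v) rules" where
  Sort: "Sort s \<in> terms ar sr R"
| Var: "Var x \<in> terms ar sr R"
| ACst: "C \<in> CFBox sr R \<Longrightarrow> a \<in> sexps ar \<Longrightarrow> ACst C a \<in> terms ar sr R"
| Sym: "f \<notin> CFBox sr R \<Longrightarrow> Sym f \<in> terms ar sr R"
| Lam: "U \<in> terms ar sr R \<Longrightarrow> t \<in> terms ar sr R \<Longrightarrow> Lam U t \<in> terms ar sr R"
| Prod: "U \<in> terms ar sr R \<Longrightarrow> V \<in> terms ar sr R \<Longrightarrow> Prod U V \<in> terms ar sr R"
| App: "t \<in> terms ar sr R \<Longrightarrow> u \<in> terms ar sr R \<Longrightarrow> App t u \<in> terms ar sr R"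

definition rewrite_rules ::
    "('h \<Rightarrow> nat) \<Rightarrow> ('f \<Rightarrow> srt) \<Rightarrow> ('f, 'h, 'v) rules \<Rightarrow> bool" where
  "rewrite_rules ar sr R \<longleftrightarrow>
     (\<forall>(l, r)\<in>R. l \<in> terms ar sr R \<and> r \<in> terms ar sr R \<and> (\<exists>f. heads f l))"

text \<open>Parallel, capture-avoiding renaming and substitution.\<close>

primrec ren :: "(nat \<Rightarrow> nat) \<Rightarrow> ('f, 'h, 'v) trm \<Rightarrow> ('f, 'h, 'v) trm" where
  "ren \<rho> (Sort s) = Sort s"
| "ren \<rho> (Var x) = Var (\<rho> x)"
| "ren \<rho> (ACst C a) = ACst C a"
| "ren \<rho> (Sym f) = Sym f"
| "ren \<rho> (Lam U t) = Lam (ren \<rho> U) (ren (case_nat 0 (\<lambda>x. Suc (\<rho> x))) t)"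
| "ren \<rho> (Prod U V) = Prod (ren \<rho> U) (ren (case_nat 0 (\<lambda>x. Suc (\<rho> x))) V)"
| "ren \<rho> (App t u) = App (ren \<rho> t) (ren \<rho> u)"

primrec subst :: "(nat \<Rightarrow> ('f, 'h, 'v) trm) \<Rightarrow> ('f, 'h, 'v) trm \<Rightarrow> ('f, 'h, 'v) trm" where
  "subst \<sigma> (Sort s) = Sort s"
| "subst \<sigma> (Var x) = \<sigma> x"
| "subst \<sigma> (ACst C a) = ACst C a"
| "subst \<sigma> (Sym f) = Sym f"
| "subst \<sigma> (Lam U t) = Lam (subst \<sigma> U) (subst (case_nat (Var 0) (\<lambda>x. ren Suc (\<sigma> x))) t)"
| "subst \<sigma> (Prod U V) = Prod (subst \<sigma> U) (subst (case_nat (Var 0) (\<lambda>x. ren Suc (\<sigma> x))) V)"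
| "subst \<sigma> (App t u) = App (subst \<sigma> t) (subst \<sigma> u)"

inductive step :: "('f, 'h, 'v) rules \<Rightarrow> ('f, 'h, 'v) trm \<Rightarrow> ('f, 'h, 'v) trm \<Rightarrow> bool"
  for R :: "('f, 'h, 'v) rules" where
  beta: "step R (App (Lam U t) u) (subst (case_nat u Var) t)"
| rule: "(l, r) \<in> R \<Longrightarrow> step R (subst \<sigma> l) (subst \<sigma> r)"
| Lam1: "step R U U' \<Longrightarrow> step R (Lam U t) (Lam U' t)"
| Lam2: "step R t t' \<Longrightarrow> step R (Lam U t) (Lam U t')"
| Prod1: "step R U U' \<Longrightarrow> step R (Prod U V) (Prod U' V)"
| Prod2: "step R V V' \<Longrightarrow> step R (Prod U V) (Prod U V')"
| App1: "step R t t' \<Longrightarrow> step R (App t u) (App t' u)"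
| App2: "step R u u' \<Longrightarrow> step R (App t u) (App t u')"

definition red ::
    "('h \<Rightarrow> nat) \<Rightarrow> ('f \<Rightarrow> srt) \<Rightarrow> ('f, 'h, 'v) rules
      \<Rightarrow> ('f, 'h, 'v) trm \<Rightarrow> ('f, 'h, 'v) trm \<Rightarrow> bool" where
  "red ar sr R t u \<longleftrightarrow> t \<in> terms ar sr R \<and> u \<in> terms ar sr R \<and> step R t u"

definition joinable ::
    "('h \<Rightarrow> nat) \<Rightarrow> ('f \<Rightarrow> srt) \<Rightarrow> ('f, 'h, 'v) rules
      \<Rightarrow> ('f, 'h, 'v) trm \<Rightarrow> ('f, 'h, 'v) trm \<Rightarrow> bool" where
  "joinable ar sr R T U \<longleftrightarrow> (\<exists>V. (red ar sr R)\<^sup>*\<^sup>* T V \<and> (red ar sr R)\<^sup>*\<^sup>* U V)"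

text \<open>Both relations live on \<open>terms\<close>; in the rules \<open>prod\<close> and \<open>trans\<close> this follows from the
  premises.\<close>

inductive subtype ::
    "('h \<Rightarrow> nat) \<Rightarrow> (('h, 'v) sexp \<Rightarrow> ('h, 'v) sexp \<Rightarrow> bool) \<Rightarrow> ('f \<Rightarrow> srt) \<Rightarrow> ('f, 'h, 'v) rules
      \<Rightarrow> ('f, 'h, 'v) trm \<Rightarrow> ('f, 'h, 'v) trm \<Rightarrow> bool"
  for ar :: "'h \<Rightarrow> nat" and leA :: "('h, 'v) sexp \<Rightarrow> ('h, 'v) sexp \<Rightarrow> bool"
    and sr :: "'f \<Rightarrow> srt" and R :: "('f, 'h, 'v) rules" where
  refl: "T \<in> terms ar sr R \<Longrightarrow> subtype ar leA sr R T T"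
| size: "C \<in> CFBox sr R \<Longrightarrow> a \<in> sexps ar \<Longrightarrow> b \<in> sexps ar \<Longrightarrow> set ts \<subseteq> terms ar sr R \<Longrightarrow> leA a b
    \<Longrightarrow> subtype ar leA sr R (apps (ACst C a) ts) (apps (ACst C b) ts)"
| prod: "subtype ar leA sr R U' U \<Longrightarrow> subtype ar leA sr R V V'
    \<Longrightarrow> subtype ar leA sr R (Prod U V) (Prod U' V')"
| conv: "T \<in> terms ar sr R \<Longrightarrow> U \<in> terms ar sr R
    \<Longrightarrow> subtype ar leA sr R T' U' \<Longrightarrow> joinable ar sr R T T' \<Longrightarrow> joinable ar sr R U' U
    \<Longrightarrow> subtype ar leA sr R T U"
| trans: "subtype ar leA sr R T U \<Longrightarrow> subtype ar leA sr R U V \<Longrightarrow> subtype ar leA sr R T V"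

inductive subtype_t ::
    "('h \<Rightarrow> nat) \<Rightarrow> (('h, 'v) sexp \<Rightarrow> ('h, 'v) sexp \<Rightarrow> bool) \<Rightarrow> ('f \<Rightarrow> srt) \<Rightarrow> ('f, 'h, 'v) rules
      \<Rightarrow> ('f, 'h, 'v) trm \<Rightarrow> ('f, 'h, 'v) trm \<Rightarrow> bool"
  for ar :: "'h \<Rightarrow> nat" and leA :: "('h, 'v) sexp \<Rightarrow> ('h, 'v) sexp \<Rightarrow> bool"
    and sr :: "'f \<Rightarrow> srt" and R :: "('f, 'h, 'v) rules" where
  refl: "T \<in> terms ar sr R \<Longrightarrow> subtype_t ar leA sr R T T"
| size: "C \<in> CFBox sr R \<Longrightarrow> a \<in> sexps ar \<Longrightarrow> b \<in> sexps ar \<Longrightarrow> set ts \<subseteq> terms ar sr R \<Longrightarrow> leA a b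
    \<Longrightarrow> subtype_t ar leA sr R (apps (ACst C a) ts) (apps (ACst C b) ts)"
| prod: "subtype_t ar leA sr R U' U \<Longrightarrow> subtype_t ar leA sr R V V'
    \<Longrightarrow> subtype_t ar leA sr R (Prod U V) (Prod U' V')"
| conv: "T \<in> terms ar sr R \<Longrightarrow> U \<in> terms ar sr R
    \<Longrightarrow> subtype_t ar leA sr R T' U' \<Longrightarrow> joinable ar sr R T T' \<Longrightarrow> joinable ar sr R U' U
    \<Longrightarrow> subtype_t ar leA sr R T U"

end

(* Confluence lets every conversion be pushed to the outside of a derivation: T \<le> U holds iff
   T and U are joinable, or reduce to C^a ts and C^b ts with a \<le> b, or reduce to products whose
   components are contravariantly, resp. covariantly, related.  This normal form needs no
   transitivity rule, since reducts of C^a ts keep the head C^a and reducts of products are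
   products, so that two adjacent normal derivations always meet in the same shape. *)

theory Submission
  imports Defs
begin

section \<open>Heads of application spines\<close>

text \<open>Terms built by \<open>apps\<close> from different heads cannot be equal, so the
  impossible overlaps between constants, products, abstractions and rule instances are all refuted
  by comparing heads.\<close>

primrec head :: "('f, 'h, 'v) trm \<Rightarrow> ('f, 'h, 'v) trm" where
  "head (Sort s) = Sort s"
| "head (Var x) = Var x"
| "head (ACst C a) = ACst C a"
| "head (Sym f) = Sym f"
| "head (Lam U t) = Lam U t"
| "head (Prod U V) = Prod U V"
| "head (App t u) = head t"

lemma apps_Nil [simp]: "apps t [] = t"
  by (simp add: apps_def)

lemma apps_snoc [simp]: "apps t (ts @ [u]) = App (apps t ts) u"
  by (simp add: apps_def)

lemma head_apps [simp]: "head (apps t ts) = head t"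
  by (induction ts rule: rev_induct) auto

lemma heads_head: "heads f l \<Longrightarrow> head l = Sym f \<or> (\<exists>a. head l = ACst f a)"
  by (auto simp: heads_def)

text \<open>Substitution leaves symbols untouched, so instantiating a left-hand side does not change
  the symbol at its head.\<close>

lemma head_subst_Sym: "head l = Sym f \<Longrightarrow> head (subst \<sigma> l) = Sym f"
  by (induction l) auto

lemma head_subst_ACst: "head l = ACst C a \<Longrightarrow> head (subst \<sigma> l) = ACst C a"
  by (induction l) auto

inductive_simps App_in_terms [simp]: "App t u \<in> terms ar sr R"
inductive_simps Prod_in_terms [simp]: "Prod U V \<in> terms ar sr R"
inductive_simps ACst_in_terms [simp]: "ACst C a \<in> terms ar sr R"

lemma apps_in_terms [simp]:
  "apps t ts \<in> terms ar sr R \<longleftrightarrow> t \<in> terms ar sr R \<and> set ts \<subseteq> terms ar sr R"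
  by (induction ts rule: rev_induct) auto

locale size_annotated_rewriting =
  fixes ar :: "'h \<Rightarrow> nat"
    and leA :: "('h, 'v) sexp \<Rightarrow> ('h, 'v) sexp \<Rightarrow> bool"
    and sr :: "'f \<Rightarrow> srt"
    and R :: "('f, 'h, 'v) rules"
  assumes leA_trans: "transp_on (sexps ar) leA"
    and rules: "rewrite_rules ar sr R"
    and confluent: "confluentp (red ar sr R)"
begin

abbreviation Terms where "Terms \<equiv> terms ar sr R"
abbreviation reds (infix "\<rightarrow>\<^sup>*" 50) where "reds \<equiv> (red ar sr R)\<^sup>*\<^sup>*"
abbreviation join (infix "\<down>" 50) where "join \<equiv> joinable ar sr R"

text \<open>The symbol heading a left-hand side is defined by that very rule. Hence an instance of a
  left-hand side is neither a product nor a spine headed by an annotated constant from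
  \<open>CFBox\<close>.\<close>

lemma head_rule_instance:
  assumes "(l, r) \<in> R"
  obtains f where "head (subst \<sigma> l) = Sym f"
  | f a where "head (subst \<sigma> l) = ACst f a" "defined_sym R f"
proof -
  obtain f where f: "heads f l"
    using assms rules by (auto simp: rewrite_rules_def)
  then have "defined_sym R f"
    using assms by (auto simp: defined_sym_def)
  then show thesis
    using that heads_head[OF f] by (auto dest: head_subst_Sym head_subst_ACst)
qed

section \<open>Joinability under confluence\<close>

lemma reds_in_terms: "t \<rightarrow>\<^sup>* u \<Longrightarrow> t \<in> Terms \<longleftrightarrow> u \<in> Terms"
  by (induction rule: rtranclp_induct) (auto simp: red_def)

lemma join_in_terms: "T \<down> U \<Longrightarrow> T \<in> Terms \<longleftrightarrow> U \<in> Terms"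
  by (auto simp: joinable_def reds_in_terms)

lemma reds_join: "T \<rightarrow>\<^sup>* U \<Longrightarrow> T \<down> U"
  by (auto simp: joinable_def)

lemma join_sym: "T \<down> U \<Longrightarrow> U \<down> T"
  by (auto simp: joinable_def)

lemma reds_confluent:
  assumes "t \<rightarrow>\<^sup>* u" "t \<rightarrow>\<^sup>* v"
  shows "u \<down> v"
  using confluentpD[OF confluent assms] by (auto simp: joinable_def)

text \<open>Confluence closes the peak at the middle term \<open>U\<close>.\<close>

lemma join_trans:
  assumes "T \<down> U" "U \<down> V"
  shows "T \<down> V"
proof -
  obtain A B where AB: "T \<rightarrow>\<^sup>* A" "U \<rightarrow>\<^sup>* A" "U \<rightarrow>\<^sup>* B" "V \<rightarrow>\<^sup>* B"
    using assms by (auto simp: joinable_def)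
  moreover obtain W where "A \<rightarrow>\<^sup>* W" "B \<rightarrow>\<^sup>* W"
    using reds_confluent[OF AB(2,3)] by (auto simp: joinable_def)
  ultimately show ?thesis
    by (meson joinable_def rtranclp_trans)
qed

section \<open>Reducts of annotated constants and of products\<close>

text \<open>No prefix of the spine is a redex: a \<beta>-redex has an abstraction as head, and a
  rule instance has a defined or unannotated symbol as head. So the step takes place inside one
  argument; using \<open>reds\<close> pointwise covers the other arguments by reflexivity.\<close>

lemma step_apps_ACst:
  assumes "C \<in> CFBox sr R"
  shows "red ar sr R (apps (ACst C a) ts) U \<Longrightarrow>
    \<exists>us. U = apps (ACst C a) us \<and> list_all2 reds ts us"
proof (induction ts arbitrary: U rule: rev_induct)
  case Nil
  then have "step R (ACst C a) U" by (simp add: red_def)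
  then show ?case
  proof cases
    case (rule l r \<sigma>)
    then show ?thesis
      using assms by (metis CFBox_def head.simps(3) head_rule_instance mem_Collect_eq
          trm.distinct(23) trm.inject(3))
  qed
next
  case (snoc t ts)
  then have mem: "apps (ACst C a) ts \<in> Terms" "t \<in> Terms" "U \<in> Terms"
    by (auto simp: red_def)
  have refl: "list_all2 reds ts ts"
    by (simp add: list.rel_refl)
  have "step R (App (apps (ACst C a) ts) t) U"
    using snoc.prems by (simp add: red_def)
  then show ?case
  proof cases
    case (beta A b)
    then show ?thesis by (metis head.simps(3,5) head_apps trm.distinct(25))
  next
    case (rule l r \<sigma>)
    then have "head (subst \<sigma> l) = ACst C a"
      by (metis head.simps(3,7) head_apps)
    then show ?thesis
      using assms rule(3) by (auto simp: CFBox_def elim: head_rule_instance[where \<sigma> = \<sigma>])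
  next
    case (App1 t')
    then have "red ar sr R (apps (ACst C a) ts) t'"
      using mem by (simp add: red_def)
    then obtain us where "t' = apps (ACst C a) us" "list_all2 reds ts us"
      using snoc.IH by blast
    then show ?thesis
      using App1 by (intro exI[of _ "us @ [t]"]) (simp add: list_all2_appendI)
  next
    case (App2 u')
    then have "t \<rightarrow>\<^sup>* u'"
      using mem by (auto simp: red_def)
    then show ?thesis
      using App2 refl by (intro exI[of _ "ts @ [u']"]) (simp add: list_all2_appendI)
  qed
qed

lemma reds_apps_ACstD:
  assumes "apps (ACst C a) ts \<rightarrow>\<^sup>* U" "C \<in> CFBox sr R"
  shows "\<exists>us. U = apps (ACst C a) us \<and> list_all2 reds ts us"
  using assms(1)
proof (induction rule: rtranclp_induct)
  case base
  then show ?case by (auto simp: list.rel_refl)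
next
  case (step U V)
  then obtain us where us: "U = apps (ACst C a) us" "list_all2 reds ts us"
    by blast
  then obtain vs where "V = apps (ACst C a) vs" "list_all2 reds us vs"
    using step step_apps_ACst[OF assms(2)] by blast
  then show ?case
    using us list_all2_trans[of reds reds reds ts us vs] by (auto intro: rtranclp_trans)
qed

text \<open>\<open>red\<close> relates only members of \<open>terms\<close>, so the component that
  stays fixed during a reduction must itself be a term; this explains the two membership
  premises.\<close>

lemma reds_App:
  assumes "t \<rightarrow>\<^sup>* t'" "u \<rightarrow>\<^sup>* u'" "t \<in> Terms" "u \<in> Terms"
  shows "App t u \<rightarrow>\<^sup>* App t' u'"
proof -
  have "App t u \<rightarrow>\<^sup>* App t' u"
    using assms(1)
  proof (induction rule: rtranclp_induct)
    case (step v w)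
    then have "red ar sr R (App v u) (App w u)"
      using assms by (auto simp: red_def intro: step.App1)
    then show ?case using step by (meson rtranclp.rtrancl_into_rtrancl)
  qed simp
  moreover have "t' \<in> Terms"
    using assms reds_in_terms by blast
  have "App t' u \<rightarrow>\<^sup>* App t' u'"
    using assms(2)
  proof (induction rule: rtranclp_induct)
    case (step v w)
    then have "red ar sr R (App t' v) (App t' w)"
      using \<open>t' \<in> Terms\<close> by (auto simp: red_def intro: step.App2)
    then show ?case using step by (meson rtranclp.rtrancl_into_rtrancl)
  qed simp
  ultimately show ?thesis by (meson rtranclp_trans)
qed

lemma reds_appsI:
  assumes "list_all2 reds ts us" "h \<in> Terms" "set ts \<subseteq> Terms"
  shows "apps h ts \<rightarrow>\<^sup>* apps h us"
  using assms
proof (induction ts arbitrary: us rule: rev_induct)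
  case (snoc t ts)
  then obtain u vs where "us = vs @ [u]" "list_all2 reds ts vs" "t \<rightarrow>\<^sup>* u"
    by (auto simp: list_all2_append1 list_all2_Cons1)
  then show ?case
    using snoc by (auto intro!: reds_App)
qed simp

text \<open>A product is never a redex, so every step happens in one of its components.\<close>

lemma reds_ProdD:
  "Prod U V \<rightarrow>\<^sup>* W \<Longrightarrow> \<exists>U' V'. W = Prod U' V' \<and> U \<rightarrow>\<^sup>* U' \<and> V \<rightarrow>\<^sup>* V'"
proof (induction rule: rtranclp_induct)
  case (step W W')
  then obtain A B where AB: "W = Prod A B" "U \<rightarrow>\<^sup>* A" "V \<rightarrow>\<^sup>* B"
    by blast
  have mem: "A \<in> Terms" "B \<in> Terms" "W' \<in> Terms" and "step R (Prod A B) W'"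
    using step AB by (auto simp: red_def)
  from this(4) show ?case
  proof cases
    case (rule l r \<sigma>)
    then show ?thesis
      by (metis head.simps(6) head_rule_instance trm.distinct(27,33))
  next
    case (Prod1 A')
    then have "A \<rightarrow>\<^sup>* A'" using mem by (auto simp: red_def)
    then show ?thesis using Prod1 AB rtranclp_trans[of _ U A A'] by auto
  next
    case (Prod2 B')
    then have "B \<rightarrow>\<^sup>* B'" using mem by (auto simp: red_def)
    then show ?thesis using Prod2 AB rtranclp_trans[of _ V B B'] by auto
  qed
qed blast

lemma join_ProdD: "Prod U V \<down> Prod U' V' \<Longrightarrow> U \<down> U' \<and> V \<down> V'"
  unfolding joinable_def by (blast dest: reds_ProdD)

lemma not_apps_ACst_join_Prod:
  assumes "C \<in> CFBox sr R"
  shows "\<not> apps (ACst C a) ts \<down> Prod U V"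
proof
  assume "apps (ACst C a) ts \<down> Prod U V"
  then obtain us U' V' where "apps (ACst C a) us = Prod U' V'"
    using reds_apps_ACstD[OF _ assms] reds_ProdD by (metis joinable_def)
  then show False
    by (metis head.simps(3,6) head_apps trm.distinct(27))
qed

lemma apps_ACst_inject:
  assumes "apps (ACst C a) ts = apps (ACst D b) us"
  shows "C = D \<and> a = b \<and> ts = us"
proof -
  have "C = D" "a = b"
    using arg_cong[OF assms, of head] by auto
  moreover have "ts = us"
    using assms
  proof (induction ts arbitrary: us rule: rev_induct)
    case Nil
    then show ?case by (cases us rule: rev_cases) auto
  next
    case (snoc t ts)
    then show ?case by (cases us rule: rev_cases) auto
  qed
  ultimately show ?thesis by blast
qed

text \<open>Reduction never changes a size annotation, so a common reduct carries both heads at once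
  and its argument list is the witness \<open>vs\<close>.\<close>

lemma join_apps_ACstD:
  assumes "apps (ACst C a) ts \<down> apps (ACst D b) us" "C \<in> CFBox sr R" "D \<in> CFBox sr R"
  shows "C = D \<and> a = b \<and> (\<exists>vs. list_all2 reds ts vs \<and> list_all2 reds us vs)"
proof -
  obtain W where "apps (ACst C a) ts \<rightarrow>\<^sup>* W" "apps (ACst D b) us \<rightarrow>\<^sup>* W"
    using assms(1) by (auto simp: joinable_def)
  then show ?thesis
    using reds_apps_ACstD assms(2,3) apps_ACst_inject by metis
qed

section \<open>Normal-form subtyping and its closure under conversion\<close>

text \<open>Conversion is built into each rule, and recursion passes only through product
  components. Asking for one and the same \<open>ts\<close> on both sides of
  \<open>nsub_size\<close> loses no generality, because joinable argument lists can be reduced to a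
  common one.\<close>

inductive nsub where
  nsub_join: "T \<in> Terms \<Longrightarrow> T \<down> U \<Longrightarrow> nsub T U"
| nsub_size: "T \<rightarrow>\<^sup>* apps (ACst C a) ts \<Longrightarrow> U \<rightarrow>\<^sup>* apps (ACst C b) ts \<Longrightarrow> C \<in> CFBox sr R
    \<Longrightarrow> a \<in> sexps ar \<Longrightarrow> b \<in> sexps ar \<Longrightarrow> set ts \<subseteq> Terms \<Longrightarrow> leA a b \<Longrightarrow> nsub T U"
| nsub_prod: "T \<rightarrow>\<^sup>* Prod U V \<Longrightarrow> T' \<rightarrow>\<^sup>* Prod U' V' \<Longrightarrow> nsub U' U \<Longrightarrow> nsub V V' \<Longrightarrow> nsub T T'"

lemma nsub_in_terms: "nsub T U \<Longrightarrow> T \<in> Terms \<and> U \<in> Terms"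
  by (induction rule: nsub.induct) (auto simp: join_in_terms reds_in_terms)

lemma join_apps_ACst_reduct:
  assumes "T \<down> apps (ACst C a) ts" "C \<in> CFBox sr R"
  obtains us where "T \<rightarrow>\<^sup>* apps (ACst C a) us" "list_all2 reds ts us"
  using assms reds_apps_ACstD unfolding joinable_def by metis

lemma list_all2_reds_in_terms: "list_all2 reds ts us \<Longrightarrow> set ts \<subseteq> Terms \<longleftrightarrow> set us \<subseteq> Terms"
  by (induction rule: list_all2_induct) (auto simp: reds_in_terms)

text \<open>Weakens the reductions in \<open>nsub_size\<close> to joinability. Reductions of
  arguments do not depend on the annotation, so those found on one side can be replayed on the other
  until the argument lists coincide.\<close>

lemma nsub_sizeI:
  assumes "T \<down> apps (ACst C a) ts" "U \<down> apps (ACst C b) ts"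
    and C: "C \<in> CFBox sr R" "a \<in> sexps ar" "b \<in> sexps ar" "set ts \<subseteq> Terms" "leA a b"
  shows "nsub T U"
proof -
  obtain us where us: "T \<rightarrow>\<^sup>* apps (ACst C a) us" "list_all2 reds ts us"
    using assms by (blast elim: join_apps_ACst_reduct)
  \<comment> \<open>The argument reductions obtained from \<open>T\<close> are replayed under the
    annotation \<open>b\<close>, which moves the join with \<open>U\<close> to the list
    \<open>us\<close>.\<close>
  have "apps (ACst C b) ts \<rightarrow>\<^sup>* apps (ACst C b) us"
    using us C by (intro reds_appsI) auto
  then have "U \<down> apps (ACst C b) us"
    using assms(2) join_trans reds_join by blast
  then obtain vs where vs: "U \<rightarrow>\<^sup>* apps (ACst C b) vs" "list_all2 reds us vs"
    using C by (blast elim: join_apps_ACst_reduct)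
  have usT: "set us \<subseteq> Terms" and vsT: "set vs \<subseteq> Terms"
    using C us vs list_all2_reds_in_terms by blast+
  \<comment> \<open>Replaying back under \<open>a\<close> brings \<open>T\<close> to the list
    \<open>vs\<close> reached from \<open>U\<close>.\<close>
  then have "apps (ACst C a) us \<rightarrow>\<^sup>* apps (ACst C a) vs"
    using vs C by (intro reds_appsI) auto
  then have "T \<rightarrow>\<^sup>* apps (ACst C a) vs"
    using us by (meson rtranclp_trans)
  then show ?thesis
    using vs vsT C nsub_size by blast
qed

text \<open>Absorbs the rule (conv). Both sides are treated together because changing one side of a
  product changes the opposite side in the contravariant domain.\<close>

lemma nsub_join_closed:
  "nsub T U \<Longrightarrow> (\<forall>T'. T' \<down> T \<longrightarrow> nsub T' U) \<and> (\<forall>U'. U \<down> U' \<longrightarrow> nsub T U')"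
proof (induction rule: nsub.induct)
  case (nsub_join T U)
  then show ?case
    by (meson nsub.nsub_join join_in_terms join_trans)
next
  case (nsub_size T C a ts U b)
  then have "T \<down> apps (ACst C a) ts" "U \<down> apps (ACst C b) ts"
    by (auto intro: reds_join)
  then show ?case
    using nsub_size(3-) by (meson nsub_sizeI join_sym join_trans)
next
  case (nsub_prod T U V T' U' V')
  have "nsub S T'" if "S \<down> T" for S
  proof -
    have "S \<down> Prod U V"
      using that nsub_prod join_trans reds_join by blast
    \<comment> \<open>The common reduct of \<open>S\<close> and the product is again a product, with
      components reduced from \<open>U\<close> and \<open>V\<close>; the induction hypotheses
      transport the premises to them.\<close>
    then obtain A B where "S \<rightarrow>\<^sup>* Prod A B" "U \<rightarrow>\<^sup>* A" "V \<rightarrow>\<^sup>* B"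
      unfolding joinable_def by (blast dest: reds_ProdD)
    moreover from this have "nsub U' A" "nsub B V'"
      using nsub_prod reds_join join_sym by simp_all
    ultimately show ?thesis
      using nsub_prod(2) nsub.nsub_prod by blast
  qed
  moreover have "nsub T S" if "T' \<down> S" for S
  proof -
    have "S \<down> Prod U' V'"
      using join_sym[OF that] nsub_prod(2) join_trans reds_join by blast
    then obtain A B where "S \<rightarrow>\<^sup>* Prod A B" "U' \<rightarrow>\<^sup>* A" "V' \<rightarrow>\<^sup>* B"
      unfolding joinable_def by (blast dest: reds_ProdD)
    moreover from this have "nsub A U" "nsub V B"
      using nsub_prod reds_join join_sym by simp_all
    ultimately show ?thesis
      using nsub_prod(1) nsub.nsub_prod by blast
  qed
  ultimately show ?case by blast
qed

section \<open>Transitivity of normal-form subtyping\<close>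

text \<open>By confluence the two reducts of the middle term \<open>U\<close> join, which forces
  \<open>C = D\<close> and \<open>b = c\<close> and gives a common argument list \<open>vs\<close>.
  Transitivity of \<open>leA\<close> then yields \<open>leA a d\<close>.\<close>

lemma nsub_size_trans:
  assumes T: "T \<rightarrow>\<^sup>* apps (ACst C a) ts" and U: "U \<rightarrow>\<^sup>* apps (ACst C b) ts"
    and U': "U \<rightarrow>\<^sup>* apps (ACst D c) us" and V: "V \<rightarrow>\<^sup>* apps (ACst D d) us"
    and C: "C \<in> CFBox sr R" "a \<in> sexps ar" "b \<in> sexps ar" "set ts \<subseteq> Terms" "leA a b"
    and D: "D \<in> CFBox sr R" "c \<in> sexps ar" "d \<in> sexps ar" "set us \<subseteq> Terms" "leA c d"
  shows "nsub T V"
proof -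
  obtain vs where eq: "C = D" "b = c" and vs: "list_all2 reds ts vs" "list_all2 reds us vs"
    using join_apps_ACstD[OF reds_confluent[OF U U'] C(1) D(1)] by blast
  have "apps (ACst C a) ts \<rightarrow>\<^sup>* apps (ACst C a) vs" "apps (ACst C d) us \<rightarrow>\<^sup>* apps (ACst C d) vs"
    using vs C D eq by (auto intro!: reds_appsI)
  then have "T \<rightarrow>\<^sup>* apps (ACst C a) vs" "V \<rightarrow>\<^sup>* apps (ACst C d) vs"
    using T V eq by (auto intro: rtranclp_trans)
  moreover have "leA a d"
    using transp_onD[OF leA_trans] C D eq by blast
  moreover have "set vs \<subseteq> Terms"
    using C vs list_all2_reds_in_terms by blast
  ultimately show ?thesis
    using C D nsub_size by blast
qed

text \<open>Contravariance of products exchanges the two sides, hence the induction needs both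
  conjuncts at once.\<close>

lemma nsub_trans_both:
  "nsub T U \<Longrightarrow> (\<forall>V. nsub U V \<longrightarrow> nsub T V) \<and> (\<forall>S. nsub S T \<longrightarrow> nsub S U)"
proof (induction rule: nsub.induct)
  case (nsub_join T U)
  then show ?case using nsub_join_closed by blast
next
  case TU: (nsub_size T C a ts U b)
  have nsub: "nsub T U" using TU by (rule nsub.nsub_size)
  have "nsub T V" if "nsub U V" for V
    using that
  proof cases
    case nsub_join
    then show ?thesis using nsub nsub_join_closed by blast
  next
    case (nsub_size D c us d)
    then show ?thesis using TU nsub_size_trans by blast
  next
    \<comment> \<open>Impossible: the middle term \<open>U\<close> would reduce both to a constant
      spine and to a product.\<close>
    case (nsub_prod A B A' B')
    then show ?thesis
      using TU not_apps_ACst_join_Prod reds_confluent by blast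
  qed
  moreover have "nsub S U" if "nsub S T" for S
    using that
  proof cases
    case nsub_join
    then show ?thesis using nsub nsub_join_closed by blast
  next
    case (nsub_size D c us d)
    then show ?thesis using TU nsub_size_trans by blast
  next
    case (nsub_prod A B A' B')
    then show ?thesis
      using TU not_apps_ACst_join_Prod reds_confluent by blast
  qed
  ultimately show ?case by blast
next
  case TT': (nsub_prod T U V T' U' V')
  have nsub: "nsub T T'" using TT'(1-4) by (rule nsub.nsub_prod)
  have "nsub T W" if "nsub T' W" for W
    using that
  proof cases
    case nsub_join
    then show ?thesis using nsub nsub_join_closed by blast
  next
    case (nsub_size D c us d)
    then show ?thesis
      using TT' not_apps_ACst_join_Prod reds_confluent by blast
  next
    case (nsub_prod A B A' B')
    \<comment> \<open>The middle term \<open>T'\<close> has two product reducts, so their components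
      join. Closure under joins aligns the premises; the domains then compose by the second
      induction conjunct and the codomains by the first.\<close>
    have "A \<down> U'" "V' \<down> B"
      using join_ProdD reds_confluent TT'(2) nsub_prod(1) join_sym by blast+
    then have "nsub A' U" "nsub V B'"
      using TT' nsub_prod nsub_join_closed by blast+
    then show ?thesis
      using TT'(1) nsub_prod(2) nsub.nsub_prod by blast
  qed
  moreover have "nsub S T'" if "nsub S T" for S
    using that
  proof cases
    case nsub_join
    then show ?thesis using nsub nsub_join_closed by blast
  next
    case (nsub_size D c us d)
    then show ?thesis
      using TT' not_apps_ACst_join_Prod reds_confluent by blast
  next
    case (nsub_prod A B A' B')
    have "U \<down> A'" "B' \<down> V"
      using join_ProdD reds_confluent TT'(1) nsub_prod(2) join_sym by blast+
    then have "nsub U' A" "nsub B V'"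
      using TT' nsub_prod nsub_join_closed by blast+
    then show ?thesis
      using TT'(2) nsub_prod(1) nsub.nsub_prod by blast
  qed
  ultimately show ?case by blast
qed

section \<open>Equality of the two subtyping relations\<close>

lemma subtype_imp_nsub: "subtype ar leA sr R T U \<Longrightarrow> nsub T U"
proof (induction rule: subtype.induct)
  case (refl T)
  then show ?case by (auto intro: nsub_join reds_join)
next
  case (size C a b ts)
  then show ?case by (blast intro: nsub_size)
next
  case (prod U' U V V')
  then show ?case by (blast intro: nsub_prod)
next
  case (conv T U T' U')
  then show ?case using nsub_join_closed by blast
next
  case (trans T U V)
  then show ?case using nsub_trans_both by blast
qed

text \<open>Each normal form unfolds to one use of (refl), (size) or (prod), wrapped in a single
  (conv) that returns to the original terms.\<close>

lemma nsub_imp_subtype_t: "nsub T U \<Longrightarrow> subtype_t ar leA sr R T U"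
proof (induction rule: nsub.induct)
  case (nsub_join T U)
  then show ?case
    by (meson join_in_terms reds_join rtranclp.rtrancl_refl subtype_t.conv subtype_t.refl)
next
  case (nsub_size T C a ts U b)
  then have "subtype_t ar leA sr R (apps (ACst C a) ts) (apps (ACst C b) ts)"
    by (intro subtype_t.size)
  moreover have "T \<in> Terms" "U \<in> Terms"
    using nsub_size by (auto simp: reds_in_terms)
  ultimately show ?case
    using nsub_size subtype_t.conv reds_join join_sym by blast
next
  case (nsub_prod T U V T' U' V')
  then have "subtype_t ar leA sr R (Prod U V) (Prod U' V')"
    by (intro subtype_t.prod)
  moreover have "T \<in> Terms" "T' \<in> Terms"
    using nsub_prod nsub_in_terms by (auto simp: reds_in_terms)
  ultimately show ?case
    using nsub_prod subtype_t.conv reds_join join_sym by blast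
qed

end

lemma subtype_t_imp_subtype: "subtype_t ar leA sr R T U \<Longrightarrow> subtype ar leA sr R T U"
  by (induction rule: subtype_t.induct) (auto intro: subtype.intros)

theorem mainTheorem2:
  fixes ar :: "'h \<Rightarrow> nat"
    and leA :: "('h, 'v) sexp \<Rightarrow> ('h, 'v) sexp \<Rightarrow> bool"
    and sr :: "'f \<Rightarrow> srt"
    and R :: "('f, 'h, 'v) rules"
  assumes "reflp_on (sexps ar) leA"
    and "transp_on (sexps ar) leA"
    and "rewrite_rules ar sr R"
    and "confluentp (red ar sr R)"
  shows "subtype_t ar leA sr R = subtype ar leA sr R"
proof -
  interpret size_annotated_rewriting ar leA sr R
    using assms by unfold_locales
  show ?thesis
    by (intro ext iffI) (blast intro: subtype_t_imp_subtype nsub_imp_subtype_t subtype_imp_nsub)+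
qed

end
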